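(* Let $\mu\geq 2$ be an integer, let $I_0,I_1\subseteq\mathbb{R}$ be intervals, and let $\Lambda\in\Theta$ be a parameter value. Let $f_0(\cdot,\Lambda):I_0\to I_1$ and $f_1(\cdot,\Lambda):I_1\to I_0$ be maps with $f_0\in\mathcal{C}^{\mu+1}(I_0)$ and $f_1\in\mathcal{C}^{\mu+1}(I_1)$ in the dynamic variable $x$, and let $F=f_1\circ f_0$ and $G=f_0\circ f_1$. Suppose that: 1. there exist $a\in I_0$ and $b=f_0(a,\Lambda)\in I_1$ that are fixed points of $F$ and $G$ respectively, i.e. $F(a,\Lambda)=a$ and $G(b,\Lambda)=b$; 2. $\partial_xF(x,\Lambda)|_{x=a}=\partial_xf_1(x,\Lambda)|_{x=b}\cdot\partial_xf_0(x,\Lambda)|_{x=a}=1$; 3. $\partial_{x^i}F(x,\Lambda)|_{x=a}=0$ for every $2\leq i\leq\mu$; 4. $\partial_{x^{\mu+1}}F(x,\Lambda)|_{x=a}\neq 0$. Then $$\partial_{x^i}G(x,\Lambda)|_{x=b}=0\quad\text{for every }2\leq i\leq\mu,\qquad\text{and}\qquad \partial_{x^{\mu+1}}G(x,\Lambda)|_{x=b}\neq 0.$$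
   Context: Intervals are real intervals, not necessarily compact, possibly all of $\mathbb{R}$. $\Theta\subset\mathbb{R}^\mu$ is the parameter set; the parameter $\Lambda$ is fixed in this statement. All compositions are in the dynamic variable $x$ only: $(g\circ f)(x,\Lambda)=g(f(x,\Lambda),\Lambda)$. $\mathcal{C}^{s}(I)$ is the set of functions on $I$ with continuous derivatives up to order $s$. $\partial_{x^i}$ denotes the $i$-th derivative with respect to $x$. *)

theory Defs
  imports "HOL-Analysis.Analysis"
begin

text \<open>
  Intervals may be open, closed, half-open or unbounded. One-point (and empty) intervals are
  excluded, since derivatives are meaningless there.
\<close>

definition nondegenerate_interval :: "real set \<Rightarrow> bool" where
  "nondegenerate_interval I \<longleftrightarrow> is_interval I \<and> (\<exists>x\<in>I. \<exists>y\<in>I. x < y)"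

text \<open>
  Derivatives are taken within the domain \<open>I\<close>, hence are one-sided at an endpoint belonging to
  \<open>I\<close>. On the interior they are the ordinary iterated derivatives, see
  \<open>nderiv_on_interior\<close> below.
\<close>

primrec nderiv_on :: "real set \<Rightarrow> nat \<Rightarrow> (real \<Rightarrow> real) \<Rightarrow> real \<Rightarrow> real" where
  "nderiv_on I 0 f = f"
| "nderiv_on I (Suc n) f = (\<lambda>x. vector_derivative (nderiv_on I n f) (at x within I))"

text \<open>
  The derivative operator above is total, so the existence of each derivative has to be
  required separately from its continuity.
\<close>

definition C_on :: "nat \<Rightarrow> real set \<Rightarrow> (real \<Rightarrow> real) \<Rightarrow> bool" where
  "C_on s I f \<longleftrightarrow>
     (\<forall>i<s. \<forall>x\<in>I. nderiv_on I i f differentiable (at x within I)) \<and>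
     (\<forall>i\<le>s. continuous_on I (nderiv_on I i f))"

definition partial_x ::
  "real set \<Rightarrow> nat \<Rightarrow> (real \<Rightarrow> 'p \<Rightarrow> real) \<Rightarrow> real \<Rightarrow> 'p \<Rightarrow> real" where
  "partial_x I i f x \<Lambda> = nderiv_on I i (\<lambda>t. f t \<Lambda>) x"

definition comp_x ::
  "(real \<Rightarrow> 'p \<Rightarrow> real) \<Rightarrow> (real \<Rightarrow> 'p \<Rightarrow> real) \<Rightarrow> real \<Rightarrow> 'p \<Rightarrow> real"  (infixl "\<circ>\<^sub>x" 55) where
  "(g \<circ>\<^sub>x f) x \<Lambda> = g (f x \<Lambda>) \<Lambda>"

lemma nderiv_on_interior:
  assumes "x \<in> interior I"
  shows "nderiv_on I n f x = (deriv ^^ n) f x"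
  using assms
proof (induction n arbitrary: x)
  case 0
  then show ?case by simp
next
  case (Suc n)
  have ev: "\<forall>\<^sub>F y in nhds x. nderiv_on I n f y = (deriv ^^ n) f y"
    using Suc eventually_nhds_in_open[of "interior I" x]
    by (auto elim: eventually_mono)
  have "(nderiv_on I n f has_vector_derivative D) (at x within I) \<longleftrightarrow>
      ((deriv ^^ n) f has_field_derivative D) (at x)" for D
    unfolding at_within_interior[OF Suc.prems] has_real_derivative_iff_has_vector_derivative[symmetric]
    by (rule DERIV_cong_ev[OF refl ev refl])
  then show ?case
    by (simp add: vector_derivative_def deriv_def[of "(deriv ^^ n) f" x])
qed

end

theory Submission
  imports Defs
begin

text \<open>
  The map \<open>h = f\<^sub>0(\<cdot>, \<Lambda>)\<close> semiconjugates the two compositions: \<open>h \<circ> F = f\<^sub>0 \<circ> f\<^sub>1 \<circ> f\<^sub>0 = G \<circ> h\<close>. As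
  \<open>h'(a) \<noteq> 0\<close>, it acts near \<open>a\<close> as a change of coordinate, and the order of contact of a map with
  the identity at a fixed point does not depend on the coordinate. This avoids differentiating
  the compositions \<open>\<mu> + 1\<close> times by the formula of Faa di Bruno.

  Put \<open>n = \<mu> + 1\<close>. By Taylor's formula the hypotheses on \<open>F\<close> say that \<open>(F x - x) / (x - a)\<^sup>n\<close> tends
  to \<open>c = F\<^sup>(\<^sup>n\<^sup>)(a) / n! \<noteq> 0\<close> (\<open>contact_of_Taylor\<close>). Now
  \<open>G (h x) - h x = h (F x) - h x\<close>, which is asymptotic to \<open>h'(a) (F x - x)\<close> because \<open>h\<close> is
  continuously differentiable, and \<open>h x - b\<close> is asymptotic to \<open>h'(a) (x - a)\<close>. Hence, with
  \<open>y = h x\<close>, the quotient \<open>(G y - y) / (y - b)\<^sup>n\<close> tends to \<open>c h'(a) / h'(a)\<^sup>n \<noteq> 0\<close> as \<open>x\<close> tends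
  to \<open>a\<close> (\<open>contact_transport\<close>). Finally, \<open>G\<close> has a Taylor expansion at \<open>b\<close>, and its coefficients
  are determined by this limit (\<open>Taylor_of_contact_along\<close>).

  The points \<open>a\<close> and \<open>b\<close> may be endpoints, so \<open>h x\<close> need not run through a neighbourhood of \<open>b\<close>.
  This is harmless: a polynomial expansion is already determined along any filter on which
  \<open>y\<close> tends to \<open>b\<close> with \<open>y \<noteq> b\<close> (\<open>Taylor_coeffs_unique_along\<close>).
\<close>

section \<open>Iterated derivatives of compositions on an interval\<close>

lemma at_within_nondegenerate_neq_bot:
  assumes "nondegenerate_interval I" "x \<in> I"
  shows "at x within I \<noteq> bot"
proof -
  from assms obtain u v where "u \<in> I" "v \<in> I" "u < v"
    by (auto simp: nondegenerate_interval_def)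
  then have "I \<noteq> {x}" by auto
  moreover have "connected I"
    using assms by (simp add: nondegenerate_interval_def is_interval_connected)
  ultimately have "x islimpt I"
    using connected_imp_perfect assms(2) by blast
  then show ?thesis by (simp add: trivial_limit_within)
qed

lemma nderiv_on_Suc_eqI:
  assumes "nondegenerate_interval I" "x \<in> I"
    and "(nderiv_on I n f has_real_derivative D) (at x within I)"
  shows "nderiv_on I (Suc n) f x = D"
  using vector_derivative_within[OF at_within_nondegenerate_neq_bot[OF assms(1,2)]] assms(3)
  by (simp add: has_real_derivative_iff_has_vector_derivative)

lemma nderiv_on_has_derivative:
  assumes "C_on s I f" "i < s" "x \<in> I"
  shows "(nderiv_on I i f has_real_derivative nderiv_on I (Suc i) f x) (at x within I)"
  using assms
  by (simp add: C_on_def vector_derivative_works has_real_derivative_iff_has_vector_derivative)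

lemma nderiv_on_cong:
  assumes "\<And>x. x \<in> I \<Longrightarrow> f x = g x" "x \<in> I"
  shows "nderiv_on I n f x = nderiv_on I n g x"
  using assms(2)
proof (induction n arbitrary: x)
  case 0
  then show ?case using assms(1) by simp
next
  case (Suc n)
  then have "(nderiv_on I n f has_vector_derivative D) (at x within I) \<longleftrightarrow>
      (nderiv_on I n g has_vector_derivative D) (at x within I)" for D
    by (auto elim!: has_vector_derivative_transform[rotated 2])
  then show ?case by (simp add: vector_derivative_def)
qed

text \<open>
  The iterated derivative is defined by differentiating last; inductions over the smoothness
  order of sums, products and compositions need the form that differentiates first.
\<close>

lemma nderiv_on_shift: "nderiv_on I (Suc n) f = nderiv_on I n (nderiv_on I 1 f)"
  by (induction n) simp_all

lemma C_on_cong: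
  assumes "\<And>x. x \<in> I \<Longrightarrow> f x = g x" "C_on s I g"
  shows "C_on s I f"
proof -
  have eq: "nderiv_on I i f x = nderiv_on I i g x" if "x \<in> I" for i x
    using assms(1) that by (rule nderiv_on_cong)
  have "nderiv_on I i f differentiable (at x within I)" if "i < s" "x \<in> I" for i x
  proof -
    have "(nderiv_on I i g has_real_derivative nderiv_on I (Suc i) g x) (at x within I)"
      using nderiv_on_has_derivative[OF assms(2) that] .
    then have "(nderiv_on I i f has_vector_derivative nderiv_on I (Suc i) g x) (at x within I)"
      unfolding has_real_derivative_iff_has_vector_derivative
      by (rule has_vector_derivative_transform[OF that(2), rotated]) (rule eq)
    then show ?thesis
      by (auto simp: differentiable_def has_vector_derivative_def)
  qed
  moreover have "continuous_on I (nderiv_on I i f)" if "i \<le> s" for i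
    using assms(2) that eq by (simp add: C_on_def cong: continuous_on_cong)
  ultimately show ?thesis by (simp add: C_on_def)
qed

lemma C_on_SucD:
  assumes "C_on (Suc s) I f"
  shows "C_on s I f" "C_on s I (nderiv_on I 1 f)"
proof -
  show "C_on s I f"
    using assms by (simp add: C_on_def)
  have "nderiv_on I (Suc i) f differentiable (at x within I)" if "i < s" "x \<in> I" for i x
    using assms that unfolding C_on_def by blast
  moreover have "continuous_on I (nderiv_on I (Suc i) f)" if "i \<le> s" for i
    using assms that unfolding C_on_def by blast
  ultimately show "C_on s I (nderiv_on I 1 f)"
    unfolding C_on_def nderiv_on_shift by blast
qed

text \<open>
  Together with \<open>C_on_SucD\<close>, this gives the recursive characterization of the smoothness classes
  that drives the closure proofs below. The derivative \<open>f'\<close> may be any function with the right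
  values on \<open>I\<close>, so product and chain rule can supply it in closed form.
\<close>

lemma C_on_SucI:
  assumes I: "nondegenerate_interval I"
    and f': "\<And>x. x \<in> I \<Longrightarrow> (f has_real_derivative f' x) (at x within I)"
    and C: "C_on s I f'"
  shows "C_on (Suc s) I f"
proof -
  have "nderiv_on I 1 f x = f' x" if "x \<in> I" for x
    using nderiv_on_Suc_eqI[OF I that, of 0 f] f'[OF that] by simp
  then have C1: "C_on s I (nderiv_on I 1 f)"
    using C_on_cong C by blast
  have "nderiv_on I i f differentiable (at x within I)" if "i < Suc s" "x \<in> I" for i x
  proof (cases i)
    case 0
    then show ?thesis
      using f'[OF that(2)] by (auto simp: differentiable_def has_field_derivative_def)
  next
    case (Suc j)
    then show ?thesis
      using C1 that unfolding Suc nderiv_on_shift by (simp add: C_on_def)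
  qed
  moreover have "continuous_on I (nderiv_on I i f)" if "i \<le> Suc s" for i
  proof (cases i)
    case 0
    then show ?thesis
      using f' by (auto simp: continuous_on_eq_continuous_within intro: DERIV_continuous)
  next
    case (Suc j)
    then show ?thesis
      using C1 that unfolding Suc nderiv_on_shift by (simp add: C_on_def)
  qed
  ultimately show ?thesis by (simp add: C_on_def)
qed

lemma C_on_add:
  assumes "nondegenerate_interval I" "C_on s I f" "C_on s I g"
  shows "C_on s I (\<lambda>x. f x + g x)"
  using assms(2,3)
proof (induction s arbitrary: f g)
  case 0
  then show ?case by (simp add: C_on_def continuous_on_add)
next
  case (Suc s)
  show ?case
  proof (rule C_on_SucI[OF assms(1)])
    fix x assume "x \<in> I"
    then show "((\<lambda>x. f x + g x) has_real_derivative nderiv_on I 1 f x + nderiv_on I 1 g x)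
        (at x within I)"
      using nderiv_on_has_derivative[OF Suc.prems(1), of 0 x]
        nderiv_on_has_derivative[OF Suc.prems(2), of 0 x]
      by (auto intro: DERIV_add)
  next
    show "C_on s I (\<lambda>x. nderiv_on I 1 f x + nderiv_on I 1 g x)"
      using Suc.IH C_on_SucD(2) Suc.prems by blast
  qed
qed

lemma C_on_mult:
  assumes "nondegenerate_interval I" "C_on s I f" "C_on s I g"
  shows "C_on s I (\<lambda>x. f x * g x)"
  using assms(2,3)
proof (induction s arbitrary: f g)
  case 0
  then show ?case by (simp add: C_on_def continuous_on_mult)
next
  case (Suc s)
  show ?case
  proof (rule C_on_SucI[OF assms(1)])
    fix x assume "x \<in> I"
    then show "((\<lambda>x. f x * g x) has_real_derivative nderiv_on I 1 f x * g x + nderiv_on I 1 g x * f x)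
        (at x within I)"
      using nderiv_on_has_derivative[OF Suc.prems(1), of 0 x]
        nderiv_on_has_derivative[OF Suc.prems(2), of 0 x]
      by (auto intro: DERIV_mult)
  next
    show "C_on s I (\<lambda>x. nderiv_on I 1 f x * g x + nderiv_on I 1 g x * f x)"
      by (intro C_on_add[OF assms(1)] Suc.IH) (fact C_on_SucD[OF Suc.prems(1)] C_on_SucD[OF Suc.prems(2)])+
  qed
qed

text \<open>
  By induction on the order, since \<open>(g \<circ> f)' = (g' \<circ> f) \<cdot> f'\<close> is of class \<open>s\<close> when \<open>g'\<close>, \<open>f\<close> and \<open>f'\<close>
  are. The inner function stays fixed while \<open>g\<close> is replaced by its derivative.
\<close>

lemma C_on_compose:
  assumes I: "nondegenerate_interval I"
    and maps: "f ` I \<subseteq> J"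
    and "C_on s I f" "C_on s J g"
  shows "C_on s I (\<lambda>x. g (f x))"
  using assms(3,4)
proof (induction s arbitrary: g)
  case 0
  then show ?case
    using maps by (auto simp: C_on_def intro: continuous_on_compose2)
next
  case (Suc s)
  show ?case
  proof (rule C_on_SucI[OF I])
    fix x assume x: "x \<in> I"
    have "(g has_real_derivative nderiv_on J 1 g (f x)) (at (f x) within f ` I)"
      using nderiv_on_has_derivative[OF Suc.prems(2), of 0 "f x"] maps x
      by (auto intro: DERIV_subset)
    moreover have "(f has_real_derivative nderiv_on I 1 f x) (at x within I)"
      using nderiv_on_has_derivative[OF Suc.prems(1), of 0 x] x by simp
    ultimately have "(g \<circ> f has_real_derivative nderiv_on J 1 g (f x) * nderiv_on I 1 f x)
        (at x within I)"
      by (rule DERIV_image_chain)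
    then show "((\<lambda>x. g (f x)) has_real_derivative nderiv_on J 1 g (f x) * nderiv_on I 1 f x)
        (at x within I)"
      by (simp add: o_def)
  next
    show "C_on s I (\<lambda>x. nderiv_on J 1 g (f x) * nderiv_on I 1 f x)"
      using Suc.IH C_on_SucD Suc.prems C_on_mult[OF I] by blast
  qed
qed

section \<open>Taylor expansion at a point of the interval\<close>

text \<open>
  The Lagrange-type bound \<open>field_Taylor\<close> controls the remainder by the size of the top derivative.
  Applied to \<open>f x - c (x - a)\<^sup>n / n!\<close> with \<open>n = m + 1\<close> and \<open>c = f\<^sup>(\<^sup>n\<^sup>)(a)\<close>, whose \<open>n\<close>-th derivative is
  continuous and vanishes at \<open>a\<close>, it yields a remainder of smaller order than \<open>(x - a)\<^sup>n\<close>.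
\<close>

lemma Taylor_Peano_within:
  assumes I: "nondegenerate_interval I" and C: "C_on (Suc m) I f" and a: "a \<in> I"
  shows "((\<lambda>x. (f x - (\<Sum>k\<le>Suc m. nderiv_on I k f a / fact k * (x - a) ^ k)) / (x - a) ^ Suc m)
           \<longlongrightarrow> 0) (at a within I)"
proof (rule tendstoI)
  fix e :: real assume "e > 0"
  let ?n = "Suc m"
  define c where "c = nderiv_on I ?n f a"
  \<comment> \<open>\<open>g i\<close> is the \<open>i\<close>-th derivative of \<open>f x - c (x - a)\<^sup>n / n!\<close>.\<close>
  define g where "g i x = nderiv_on I i f x - c * (x - a) ^ (?n - i) / fact (?n - i)" for i x
  have "continuous_on I (nderiv_on I ?n f)"
    using C by (simp add: C_on_def del: nderiv_on.simps)
  then obtain d where "d > 0"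
    and d: "\<And>x. x \<in> I \<Longrightarrow> dist x a < d \<Longrightarrow> \<bar>nderiv_on I ?n f x - c\<bar> < e / 2"
    unfolding continuous_on_iff c_def using a \<open>e > 0\<close> half_gt_zero
    by (metis dist_real_def)
  let ?S = "I \<inter> ball a d"
  have conv: "convex ?S"
    using I by (simp add: nondegenerate_interval_def is_interval_convex convex_Int)
  have deriv: "(g i has_field_derivative g (Suc i) x) (at x within ?S)"
    if "x \<in> ?S" "i \<le> m" for i x
  proof -
    have "(nderiv_on I i f has_real_derivative nderiv_on I (Suc i) f x) (at x within ?S)"
      using nderiv_on_has_derivative[OF C, of i x] that DERIV_subset[of _ _ x I ?S] by auto
    moreover have "((\<lambda>x. c * (x - a) ^ Suc (m - i) / fact (Suc (m - i)))
        has_real_derivative c * (x - a) ^ (m - i) / fact (m - i)) (at x within ?S)"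
      by (rule derivative_eq_intros refl | simp add: fact_Suc del: power_Suc)+
    ultimately have "((\<lambda>x. nderiv_on I i f x - c * (x - a) ^ Suc (m - i) / fact (Suc (m - i)))
        has_real_derivative nderiv_on I (Suc i) f x - c * (x - a) ^ (m - i) / fact (m - i))
        (at x within ?S)"
      by (rule DERIV_diff)
    then show ?thesis
      using that(2) by (simp add: g_def[abs_def] Suc_diff_le del: nderiv_on.simps)
  qed
  have bound: "norm (g ?n x) \<le> e / 2" if "x \<in> ?S" for x
    using d[of x] that by (simp add: g_def dist_commute less_imp_le del: nderiv_on.simps)
  have "\<bar>(f x - (\<Sum>k\<le>?n. nderiv_on I k f a / fact k * (x - a) ^ k)) / (x - a) ^ ?n\<bar> < e"
    if x: "x \<in> I" "x \<noteq> a" "dist x a < d" for x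
  proof -
    have "norm (g 0 x - (\<Sum>i\<le>m. g i a * (x - a) ^ i / fact i)) \<le> e / 2 * norm (x - a) ^ Suc m / fact m"
      using field_Taylor[OF conv deriv bound, of a x] a x \<open>d > 0\<close> by (simp add: dist_commute)
    also have "(\<Sum>i\<le>m. g i a * (x - a) ^ i / fact i) = (\<Sum>k\<le>m. nderiv_on I k f a / fact k * (x - a) ^ k)"
      by (rule sum.cong) (auto simp: g_def Suc_diff_le)
    also have "g 0 x - (\<Sum>k\<le>m. nderiv_on I k f a / fact k * (x - a) ^ k) =
        f x - (\<Sum>k\<le>?n. nderiv_on I k f a / fact k * (x - a) ^ k)"
      by (simp add: g_def c_def del: nderiv_on.simps(2))
    also have "e / 2 * norm (x - a) ^ Suc m / fact m \<le> e / 2 * norm (x - a) ^ Suc m"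
      using \<open>e > 0\<close> fact_ge_1[of m, where 'a = real]
        mult_left_mono[of 1 "fact m" "e / 2 * norm (x - a) ^ Suc m"]
      by (simp add: divide_le_eq del: power_Suc)
    also have "\<dots> < e * norm (x - a) ^ Suc m"
      using \<open>e > 0\<close> x by simp
    finally show ?thesis
      using x by (simp add: abs_divide power_abs divide_less_eq del: power_Suc nderiv_on.simps sum.atMost_Suc)
  qed
  then show "\<forall>\<^sub>F x in at a within I. dist ((f x -
      (\<Sum>k\<le>?n. nderiv_on I k f a / fact k * (x - a) ^ k)) / (x - a) ^ ?n) 0 < e"
    using \<open>d > 0\<close> unfolding eventually_at dist_real_def by (auto simp del: sum.atMost_Suc)
qed

text \<open>
  If \<open>k\<close> is the least index whose coefficient is in question, dividing the polynomial by \<open>t\<^sup>k\<close>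
  leaves a quantity that tends to \<open>d k\<close>, while the growth condition forces it to tend to \<open>0\<close>.
\<close>

lemma Taylor_coeffs_unique_along:
  fixes t :: "'a \<Rightarrow> real"
  assumes "L \<noteq> bot" and t0: "(t \<longlongrightarrow> 0) L" and tnz: "\<forall>\<^sub>F x in L. t x \<noteq> 0"
    and lim: "((\<lambda>x. (\<Sum>j\<le>n. d j * t x ^ j) / t x ^ n) \<longlongrightarrow> 0) L"
    and "k \<le> n"
  shows "d k = 0"
  using \<open>k \<le> n\<close>
proof (induction k rule: less_induct)
  case (less k)
  \<comment> \<open>For \<open>j < k\<close> the truncated exponent \<open>j - k = 0\<close> does no harm, as \<open>d j = 0\<close> by induction.\<close>
  have "((\<lambda>x. \<Sum>j\<le>n. d j * t x ^ (j - k)) \<longlongrightarrow> (\<Sum>j\<le>n. d j * 0 ^ (j - k))) L"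
    by (intro tendsto_intros t0)
  also have "(\<Sum>j\<le>n. d j * 0 ^ (j - k)) = (\<Sum>j\<le>n. if j = k then d j else 0)"
    using less by (intro sum.cong) (auto simp: power_0_left)
  also have "\<dots> = d k"
    using less.prems by simp
  finally have A: "((\<lambda>x. \<Sum>j\<le>n. d j * t x ^ (j - k)) \<longlongrightarrow> d k) L" .
  have "((\<lambda>x. (\<Sum>j\<le>n. d j * t x ^ j) / t x ^ n * t x ^ (n - k)) \<longlongrightarrow> 0 * 0 ^ (n - k)) L"
    by (intro tendsto_intros t0 lim)
  moreover have "\<forall>\<^sub>F x in L. (\<Sum>j\<le>n. d j * t x ^ j) / t x ^ n * t x ^ (n - k) =
      (\<Sum>j\<le>n. d j * t x ^ (j - k))"
    using tnz
  proof eventually_elim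
    case (elim x)
    have "d j * t x ^ j = t x ^ k * (d j * t x ^ (j - k))" if "j \<le> n" for j
      using less that by (cases "j < k") (auto simp flip: power_add)
    then have "(\<Sum>j\<le>n. d j * t x ^ j) = t x ^ k * (\<Sum>j\<le>n. d j * t x ^ (j - k))"
      unfolding sum_distrib_left by (intro sum.cong) auto
    moreover have "t x ^ n = t x ^ k * t x ^ (n - k)"
      using less.prems by (simp flip: power_add)
    ultimately show ?case using elim by simp
  qed
  ultimately have "((\<lambda>x. \<Sum>j\<le>n. d j * t x ^ (j - k)) \<longlongrightarrow> 0 * 0 ^ (n - k)) L"
    by (rule Lim_transform_eventually)
  from tendsto_unique[OF \<open>L \<noteq> bot\<close> A this] show ?case
    by simp
qed

section \<open>Contact with the identity\<close>

text \<open>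
  Under these hypotheses the Taylor polynomial of \<open>f\<close> at \<open>a\<close> collapses to
  \<open>x + f\<^sup>(\<^sup>n\<^sup>)(a) / n! \<cdot> (x - a)\<^sup>n\<close>.
\<close>

lemma contact_of_Taylor:
  assumes I: "nondegenerate_interval I" and C: "C_on n I f" and "2 \<le> n"
    and a: "a \<in> I" and fix_a: "f a = a" and "nderiv_on I 1 f a = 1"
    and "\<And>i. 2 \<le> i \<Longrightarrow> i < n \<Longrightarrow> nderiv_on I i f a = 0"
  shows "((\<lambda>x. (f x - x) / (x - a) ^ n) \<longlongrightarrow> nderiv_on I n f a / fact n) (at a within I)"
proof -
  let ?c = "nderiv_on I n f a / fact n"
  obtain m where m: "n = Suc m" using \<open>2 \<le> n\<close> by (cases n) auto
  have "(\<Sum>k\<le>n. nderiv_on I k f a / fact k * (x - a) ^ k) = x + ?c * (x - a) ^ n" for x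
  proof -
    have "(\<Sum>k\<le>n. nderiv_on I k f a / fact k * (x - a) ^ k) =
        (\<Sum>k\<in>{0, 1, n}. nderiv_on I k f a / fact k * (x - a) ^ k)"
    proof (intro sum.mono_neutral_right ballI)
      fix i assume "i \<in> {..n} - {0, 1, n}"
      then have "2 \<le> i" "i < n" by auto
      then show "nderiv_on I i f a / fact i * (x - a) ^ i = 0"
        using assms(7) by simp
    qed (use \<open>2 \<le> n\<close> in auto)
    also have "\<dots> = x + ?c * (x - a) ^ n"
      using assms(3,5,6) by simp
    finally show ?thesis .
  qed
  then have "((\<lambda>x. (f x - (x + ?c * (x - a) ^ n)) / (x - a) ^ n) \<longlongrightarrow> 0) (at a within I)"
    using Taylor_Peano_within[of I m f a] I C a m by simp
  then have "((\<lambda>x. (f x - (x + ?c * (x - a) ^ n)) / (x - a) ^ n + ?c) \<longlongrightarrow> 0 + ?c) (at a within I)"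
    by (rule tendsto_add[OF _ tendsto_const])
  moreover have "\<forall>\<^sub>F x in at a within I.
      (f x - (x + ?c * (x - a) ^ n)) / (x - a) ^ n + ?c = (f x - x) / (x - a) ^ n"
    unfolding eventually_at_filter by (simp add: diff_divide_distrib add_divide_distrib)
  ultimately have "((\<lambda>x. (f x - x) / (x - a) ^ n) \<longlongrightarrow> 0 + ?c) (at a within I)"
    by (rule Lim_transform_eventually)
  then show ?thesis by simp
qed

text \<open>
  Continuity of the derivative allows both ends of the difference quotient to move: by the mean
  value inequality, \<open>h x - h'(a) x\<close> is Lipschitz near \<open>a\<close> with an arbitrarily small constant.
\<close>

lemma strict_derivative_tendsto:
  fixes h :: "real \<Rightarrow> real"
  assumes I: "nondegenerate_interval I" and C: "C_on 1 I h" and a: "a \<in> I"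
    and u: "(u \<longlongrightarrow> a) L" "\<forall>\<^sub>F x in L. u x \<in> I"
    and v: "(v \<longlongrightarrow> a) L" "\<forall>\<^sub>F x in L. v x \<in> I"
    and neq: "\<forall>\<^sub>F x in L. u x \<noteq> v x"
  shows "((\<lambda>x. (h (u x) - h (v x)) / (u x - v x)) \<longlongrightarrow> nderiv_on I 1 h a) L"
proof (rule tendstoI)
  fix e :: real assume "e > 0"
  let ?D = "nderiv_on I 1 h"
  have "continuous_on I ?D"
    using C by (simp add: C_on_def del: nderiv_on.simps)
  then obtain d where "d > 0" and d: "\<And>x. x \<in> I \<Longrightarrow> dist x a < d \<Longrightarrow> \<bar>?D x - ?D a\<bar> < e / 2"
    unfolding continuous_on_iff using a \<open>e > 0\<close> half_gt_zero by (metis dist_real_def)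
  let ?S = "I \<inter> ball a d"
  have conv: "convex ?S"
    using I by (simp add: nondegenerate_interval_def is_interval_convex convex_Int)
  have deriv: "((\<lambda>x. h x - ?D a * x) has_field_derivative (?D x - ?D a)) (at x within ?S)"
    if "x \<in> ?S" for x
  proof -
    have "(h has_real_derivative ?D x) (at x within ?S)"
      using nderiv_on_has_derivative[OF C, of 0 x] that DERIV_subset[of _ _ x I ?S] by auto
    then show ?thesis
      by (auto intro!: derivative_eq_intros simp del: nderiv_on.simps)
  qed
  have bound: "norm (?D x - ?D a) \<le> e / 2" if "x \<in> ?S" for x
    using d[of x] that by (simp add: dist_commute less_imp_le del: nderiv_on.simps)
  have "\<forall>\<^sub>F x in L. dist (u x) a < d" "\<forall>\<^sub>F x in L. dist (v x) a < d"
    using tendstoD[OF u(1) \<open>d > 0\<close>] tendstoD[OF v(1) \<open>d > 0\<close>] .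
  with u(2) v(2) neq
  show "\<forall>\<^sub>F x in L. dist ((h (u x) - h (v x)) / (u x - v x)) (?D a) < e"
  proof eventually_elim
    case (elim x)
    have "norm ((h (u x) - ?D a * u x) - (h (v x) - ?D a * v x)) \<le> e / 2 * norm (u x - v x)"
      by (rule field_differentiable_bound[OF conv deriv bound])
        (use elim in \<open>auto simp: dist_commute\<close>)
    also have "\<dots> < e * \<bar>u x - v x\<bar>"
      using elim \<open>e > 0\<close> by simp
    also have "(h (u x) - ?D a * u x) - (h (v x) - ?D a * v x) =
        ((h (u x) - h (v x)) / (u x - v x) - ?D a) * (u x - v x)"
      using elim by (simp add: field_simps del: nderiv_on.simps)
    finally show ?case
      using elim by (simp add: dist_real_def abs_mult del: nderiv_on.simps)
  qed
qed

text \<open>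
  Factor the quotient as
  \<open>(h (f x) - h x) / (f x - x) \<cdot> (f x - x) / (x - a)\<^sup>n \<cdot> ((x - a) / (h x - h a))\<^sup>n\<close>. The denominators
  do not vanish near \<open>a\<close>, because \<open>c \<noteq> 0\<close> gives \<open>f x \<noteq> x\<close> and \<open>h'(a) \<noteq> 0\<close> gives \<open>h x \<noteq> h a\<close>.
\<close>

lemma contact_transport:
  fixes h :: "real \<Rightarrow> real"
  assumes I: "nondegenerate_interval I" and C: "C_on 1 I h" and a: "a \<in> I"
    and D: "nderiv_on I 1 h a \<noteq> 0"
    and f: "f ` I \<subseteq> I" "(f \<longlongrightarrow> a) (at a within I)"
    and contact: "((\<lambda>x. (f x - x) / (x - a) ^ n) \<longlongrightarrow> c) (at a within I)" "c \<noteq> 0"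
  shows "((\<lambda>x. (h (f x) - h x) / (h x - h a) ^ n) \<longlongrightarrow>
      nderiv_on I 1 h a * c * (1 / nderiv_on I 1 h a) ^ n) (at a within I)"
proof -
  let ?D = "nderiv_on I 1 h a"
  have self: "\<forall>\<^sub>F x in at a within I. x \<in> I \<and> x \<noteq> a"
    by (simp add: eventually_at_filter)
  have "\<forall>\<^sub>F x in at a within I. (f x - x) / (x - a) ^ n \<noteq> 0"
    using contact by (rule tendsto_imp_eventually_ne)
  then have fne: "\<forall>\<^sub>F x in at a within I. f x \<noteq> x"
    by eventually_elim auto
  have 1: "((\<lambda>x. (h (f x) - h x) / (f x - x)) \<longlongrightarrow> ?D) (at a within I)"
    by (rule strict_derivative_tendsto[OF I C a f(2) _ tendsto_ident_at _ fne])
      (use self f(1) in \<open>auto elim!: eventually_mono\<close>)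
  have 2: "((\<lambda>x. (h x - h a) / (x - a)) \<longlongrightarrow> ?D) (at a within I)"
    using nderiv_on_has_derivative[OF C, of 0 a] a by (simp add: has_field_derivative_iff)
  have hne: "\<forall>\<^sub>F x in at a within I. h x \<noteq> h a"
    using tendsto_imp_eventually_ne[OF 2 D] by eventually_elim auto
  have "((\<lambda>x. (h (f x) - h x) / (f x - x) * ((f x - x) / (x - a) ^ n) * (1 / ((h x - h a) / (x - a))) ^ n)
      \<longlongrightarrow> ?D * c * (1 / ?D) ^ n) (at a within I)"
    by (intro tendsto_intros 1 2 contact D)
  moreover have "\<forall>\<^sub>F x in at a within I.
      (h (f x) - h x) / (f x - x) * ((f x - x) / (x - a) ^ n) * (1 / ((h x - h a) / (x - a))) ^ n =
      (h (f x) - h x) / (h x - h a) ^ n"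
    using self fne hne by eventually_elim (simp add: power_divide)
  ultimately show ?thesis
    by (rule Lim_transform_eventually)
qed

text \<open>
  A converse of \<open>contact_of_Taylor\<close>, where the contact is known only along a filter on which \<open>y\<close>
  tends to \<open>b\<close> within \<open>I\<close>. Both the Taylor polynomial of \<open>g\<close> and \<open>y + c (y - b)\<^sup>n\<close> approximate
  \<open>g y\<close> up to smaller order than \<open>(y - b)\<^sup>n\<close>, so their coefficients agree.
\<close>

lemma Taylor_of_contact_along:
  assumes I: "nondegenerate_interval I" and C: "C_on n I g" and "2 \<le> n" and b: "b \<in> I"
    and L: "L \<noteq> bot" and y: "filterlim y (at b within I) L"
    and contact: "((\<lambda>x. (g (y x) - y x) / (y x - b) ^ n) \<longlongrightarrow> c) L"
  shows "\<And>i. 2 \<le> i \<Longrightarrow> i < n \<Longrightarrow> nderiv_on I i g b = 0"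
    and "nderiv_on I n g b = fact n * c"
proof -
  obtain m where m: "n = Suc m" using \<open>2 \<le> n\<close> by (cases n) auto
  \<comment> \<open>\<open>p\<close> lists the coefficients of \<open>y + c (y - b)\<^sup>n\<close> in powers of \<open>y - b\<close>.\<close>
  define p where "p k = (if k = 0 then b else if k = 1 then 1 else if k = n then c else 0)" for k
  define d where "d k = nderiv_on I k g b / fact k - p k" for k
  have p: "(\<Sum>k\<le>n. p k * z ^ k) = b + z + c * z ^ n" for z
  proof -
    have "(\<Sum>k\<le>n. p k * z ^ k) = (\<Sum>k\<in>{0, 1, n}. p k * z ^ k)"
      using \<open>2 \<le> n\<close> by (intro sum.mono_neutral_right) (auto simp: p_def)
    then show ?thesis using \<open>2 \<le> n\<close> by (simp add: p_def)
  qed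
  have yb: "(y \<longlongrightarrow> b) L" and yne: "\<forall>\<^sub>F x in L. y x \<noteq> b"
    using y by (auto simp: filterlim_at elim: eventually_mono)
  have "((\<lambda>z. (g z - (\<Sum>k\<le>n. nderiv_on I k g b / fact k * (z - b) ^ k)) / (z - b) ^ n) \<longlongrightarrow> 0)
      (at b within I)"
    using Taylor_Peano_within[of I m g b] I C b m by blast
  from filterlim_compose[OF this y]
  have "((\<lambda>x. (g (y x) - y x) / (y x - b) ^ n - c -
      (g (y x) - (\<Sum>k\<le>n. nderiv_on I k g b / fact k * (y x - b) ^ k)) / (y x - b) ^ n) \<longlongrightarrow> c - c - 0) L"
    by (intro tendsto_intros contact)
  moreover have "\<forall>\<^sub>F x in L. (g (y x) - y x) / (y x - b) ^ n - c -
      (g (y x) - (\<Sum>k\<le>n. nderiv_on I k g b / fact k * (y x - b) ^ k)) / (y x - b) ^ n =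
      (\<Sum>k\<le>n. d k * (y x - b) ^ k) / (y x - b) ^ n"
    using yne
  proof eventually_elim
    case (elim x)
    have "(\<Sum>k\<le>n. d k * (y x - b) ^ k) =
        (\<Sum>k\<le>n. nderiv_on I k g b / fact k * (y x - b) ^ k) - (y x + c * (y x - b) ^ n)"
      using p[of "y x - b"] by (simp add: d_def left_diff_distrib sum_subtractf)
    then show ?case using elim by (simp add: diff_divide_distrib add_divide_distrib)
  qed
  ultimately have "((\<lambda>x. (\<Sum>k\<le>n. d k * (y x - b) ^ k) / (y x - b) ^ n) \<longlongrightarrow> c - c - 0) L"
    by (rule Lim_transform_eventually)
  then have lim: "((\<lambda>x. (\<Sum>k\<le>n. d k * (y x - b) ^ k) / (y x - b) ^ n) \<longlongrightarrow> 0) L"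
    by simp
  have "((\<lambda>x. y x - b) \<longlongrightarrow> 0) L"
    using yb by (simp add: LIM_zero_iff)
  then have d0: "d k = 0" if "k \<le> n" for k
    by (rule Taylor_coeffs_unique_along[OF L _ _ lim that]) (use yne in simp)
  show "nderiv_on I i g b = 0" if "2 \<le> i" "i < n" for i
    using d0[of i] that by (simp add: d_def p_def)
  show "nderiv_on I n g b = fact n * c"
    using d0[of n] \<open>2 \<le> n\<close> by (simp add: d_def p_def field_simps)
qed

section \<open>The two compositions\<close>

theorem theorem3p2:
  fixes \<mu> :: nat
    and \<Theta> :: "(real ^ 'm) set"
    and \<Lambda> :: "real ^ 'm"
    and I\<^sub>0 I\<^sub>1 :: "real set"
    and f\<^sub>0 f\<^sub>1 F G :: "real \<Rightarrow> real ^ 'm \<Rightarrow> real"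
    and a b :: real
  assumes "\<mu> = CARD('m)" and "\<mu> \<ge> 2"
    and "\<Lambda> \<in> \<Theta>"
    and "nondegenerate_interval I\<^sub>0" and "nondegenerate_interval I\<^sub>1"
    and "\<And>x. x \<in> I\<^sub>0 \<Longrightarrow> f\<^sub>0 x \<Lambda> \<in> I\<^sub>1"
    and "\<And>x. x \<in> I\<^sub>1 \<Longrightarrow> f\<^sub>1 x \<Lambda> \<in> I\<^sub>0"
    and "C_on (\<mu> + 1) I\<^sub>0 (\<lambda>x. f\<^sub>0 x \<Lambda>)"
    and "C_on (\<mu> + 1) I\<^sub>1 (\<lambda>x. f\<^sub>1 x \<Lambda>)"
    and "F = f\<^sub>1 \<circ>\<^sub>x f\<^sub>0" and "G = f\<^sub>0 \<circ>\<^sub>x f\<^sub>1"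
    and "a \<in> I\<^sub>0" and "b = f\<^sub>0 a \<Lambda>" and "b \<in> I\<^sub>1"
    and "F a \<Lambda> = a" and "G b \<Lambda> = b"
    and "partial_x I\<^sub>0 1 F a \<Lambda> = partial_x I\<^sub>1 1 f\<^sub>1 b \<Lambda> * partial_x I\<^sub>0 1 f\<^sub>0 a \<Lambda>"
    and "partial_x I\<^sub>1 1 f\<^sub>1 b \<Lambda> * partial_x I\<^sub>0 1 f\<^sub>0 a \<Lambda> = 1"
    and "\<And>i. 2 \<le> i \<Longrightarrow> i \<le> \<mu> \<Longrightarrow> partial_x I\<^sub>0 i F a \<Lambda> = 0"
    and "partial_x I\<^sub>0 (\<mu> + 1) F a \<Lambda> \<noteq> 0"
  shows "(\<forall>i. 2 \<le> i \<and> i \<le> \<mu> \<longrightarrow> partial_x I\<^sub>1 i G b \<Lambda> = 0) \<and>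
         partial_x I\<^sub>1 (\<mu> + 1) G b \<Lambda> \<noteq> 0"
proof -
  let ?n = "\<mu> + 1"
  let ?h = "\<lambda>x. f\<^sub>0 x \<Lambda>" and ?k = "\<lambda>x. f\<^sub>1 x \<Lambda>"
  let ?F = "\<lambda>x. F x \<Lambda>" and ?G = "\<lambda>x. G x \<Lambda>"
  let ?D = "nderiv_on I\<^sub>0 1 ?h a"
  note I0 = assms(4) and I1 = assms(5) and Ch = assms(8) and Ck = assms(9) and a = assms(12)
    and b = assms(14)
  have n2: "2 \<le> ?n" using assms(2) by simp
  have F: "?F = (\<lambda>x. ?k (?h x))" and G: "?G = (\<lambda>x. ?h (?k x))"
    by (simp_all add: assms(10,11) comp_x_def)
  have CF: "C_on ?n I\<^sub>0 ?F"
    unfolding F by (rule C_on_compose[OF I0 _ Ch Ck]) (use assms(6) in auto)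
  have CG: "C_on ?n I\<^sub>1 ?G"
    unfolding G by (rule C_on_compose[OF I1 _ Ck Ch]) (use assms(7) in auto)
  have Ch1: "C_on 1 I\<^sub>0 ?h"
    using Ch by (auto simp: C_on_def)
  have D: "?D \<noteq> 0"
    using assms(18) by (auto simp: partial_x_def simp del: nderiv_on.simps)
  define c where "c = nderiv_on I\<^sub>0 ?n ?F a / fact ?n"
  have "c \<noteq> 0"
    using assms(20) by (simp add: c_def partial_x_def del: nderiv_on.simps fact_Suc)
  have contactF: "((\<lambda>x. (?F x - x) / (x - a) ^ ?n) \<longlongrightarrow> c) (at a within I\<^sub>0)"
    unfolding c_def
    by (rule contact_of_Taylor[OF I0 CF n2 a])
      (use assms(15,17,18,19) in \<open>auto simp: partial_x_def simp del: nderiv_on.simps\<close>)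
  have "continuous_on I\<^sub>0 (nderiv_on I\<^sub>0 0 ?F)"
    using CF unfolding C_on_def by blast
  then have Fa: "(?F \<longlongrightarrow> a) (at a within I\<^sub>0)"
    using a assms(15) unfolding continuous_on_def by (metis nderiv_on.simps(1))
  have "?F ` I\<^sub>0 \<subseteq> I\<^sub>0"
    unfolding F using assms(6,7) by blast
  note lim = contact_transport[OF I0 Ch1 a D this Fa contactF \<open>c \<noteq> 0\<close>]
  \<comment> \<open>The semiconjugacy turns the contact of \<open>F\<close> at \<open>a\<close> into contact of \<open>G\<close> at \<open>b\<close>.\<close>
  have "?h (?F x) = ?G (?h x)" for x
    by (simp add: assms(10,11) comp_x_def)
  with lim have contactG: "((\<lambda>x. (?G (?h x) - ?h x) / (?h x - b) ^ ?n) \<longlongrightarrow> ?D * c * (1 / ?D) ^ ?n)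
      (at a within I\<^sub>0)"
    by (simp add: assms(13))
  have deriv: "((\<lambda>x. (?h x - ?h a) / (x - a)) \<longlongrightarrow> ?D) (at a within I\<^sub>0)"
    and cont: "(?h \<longlongrightarrow> b) (at a within I\<^sub>0)"
    using nderiv_on_has_derivative[OF Ch1, of 0 a] a
      DERIV_continuous[of ?h _ a I\<^sub>0]
    by (simp_all add: has_field_derivative_iff continuous_within assms(13))
  have "\<forall>\<^sub>F x in at a within I\<^sub>0. x \<in> I\<^sub>0"
    by (simp add: eventually_at_filter)
  with tendsto_imp_eventually_ne[OF deriv D]
  have "\<forall>\<^sub>F x in at a within I\<^sub>0. ?h x \<in> I\<^sub>1 \<and> ?h x \<noteq> b"
    by eventually_elim (auto simp: assms(6,13))
  with cont have "filterlim ?h (at b within I\<^sub>1) (at a within I\<^sub>0)"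
    by (simp add: filterlim_at)
  note G_coeffs = Taylor_of_contact_along[OF I1 CG n2 b
      at_within_nondegenerate_neq_bot[OF I0 a] this contactG]
  have "nderiv_on I\<^sub>1 ?n ?G b \<noteq> 0"
    unfolding G_coeffs(2) using D \<open>c \<noteq> 0\<close> by (simp del: nderiv_on.simps fact_Suc)
  then show ?thesis
    using G_coeffs(1) by (simp add: partial_x_def del: nderiv_on.simps)
qed

end
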